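(* Let $Y=[0,1]$ or $Y=[0,\infty)$, let $(X,\mathcal{A})$ be a measurable space and let $\mu$ be a monotone measure on $\mathcal{A}$ (with values in $[0,1]$ if $Y=[0,1]$). If $\mu$ is subadditive, then $$(S)\int_X(f+g)\,d\mu\le(S)\int_X f\,d\mu+(S)\int_X g\,d\mu\qquad( * )$$ for all measurable $f,g\colon X\to Y$. Moreover, if $( * )$ holds for all measurable functions $f,g\colon X\to Y$ and $\mu(X)<\infty$, then $\mu$ is subadditive.
   Context: A monotone measure on $\mathcal{A}$ is a nondecreasing set function $\mu\colon\mathcal{A}\to[0,\infty]$ with $\mu(\emptyset)=0$; it is subadditive if $\mu(A\cup B)\le\mu(A)+\mu(B)$ for all $A,B\in\mathcal{A}$. The Sugeno integral of a nonnegative measurable function $h$ is $(S)\int_X h\,d\mu:=\sup_{y\in Y}\{\min(y,\mu(\{h\ge y\}))\}$ (the same formula is used for $h=f+g$ even if $f+g$ takes values outside $Y$). *)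

theory Defs
  imports "HOL-Analysis.Analysis"
begin

(* Throughout, M :: 'a measure only supplies the measurable space (space M, sets M); its own
   measure is never used.  The set function mu is a separate object, relevant only on sets M. *)

(* By definition, positive A mu just says mu {} = 0. *)
definition monotone_measure :: "'a measure \<Rightarrow> ('a set \<Rightarrow> ennreal) \<Rightarrow> bool" where
  "monotone_measure M \<mu> \<longleftrightarrow> positive (sets M) \<mu> \<and> increasing (sets M) \<mu>"

(* The library's subadditive constrains disjoint sets only; here A and B are arbitrary. *)
definition subadditive_set_function :: "'a measure \<Rightarrow> ('a set \<Rightarrow> ennreal) \<Rightarrow> bool" where
  "subadditive_set_function M \<mu> \<longleftrightarrow>
     (\<forall>A\<in>sets M. \<forall>B\<in>sets M. \<mu> (A \<union> B) \<le> \<mu> A + \<mu> B)"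

(* The supremum ranges over the levels y in Y even when h takes values outside Y.  Y is meant to
   consist of nonnegative reals, since ennreal sends negative reals to 0. *)
definition sugeno_integral ::
  "real set \<Rightarrow> 'a measure \<Rightarrow> ('a set \<Rightarrow> ennreal) \<Rightarrow> ('a \<Rightarrow> real) \<Rightarrow> ennreal" where
  "sugeno_integral Y M \<mu> h = (SUP y\<in>Y. min (ennreal y) (\<mu> {x \<in> space M. h x \<ge> y}))"

end

theory Submission
  imports Defs
begin

text \<open>For the first part, a level \<open>a\<close> above the Sugeno integral \<open>p\<close> of \<open>f\<close> satisfies
  \<open>\<mu> {f \<ge> a} \<le> p\<close>. A level \<open>y > p + q\<close> splits as \<open>y = a + b\<close> with \<open>a > p\<close> and \<open>b > q\<close>, and
  \<open>{f + g \<ge> y} \<subseteq> {f \<ge> a} \<union> {g \<ge> b}\<close>. For the second part, with \<open>c = \<mu> (A \<union> B)\<close>, apply the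
  inequality to \<open>f = c \<cdot> 1\<^sub>A\<close> and \<open>g = c \<cdot> 1\<^sub>B\<^sub>-\<^sub>A\<close>, whose sum is \<open>c \<cdot> 1\<^sub>A\<^sub>\<union>\<^sub>B\<close>.\<close>

lemma monotone_measure_mono:
  assumes "monotone_measure M \<mu>" "A \<in> sets M" "B \<in> sets M" "A \<subseteq> B"
  shows "\<mu> A \<le> \<mu> B"
  using assms by (auto simp: monotone_measure_def increasing_def)

lemma sugeno_integral_upper:
  assumes "y \<in> Y"
  shows "min (ennreal y) (\<mu> {x \<in> space M. h x \<ge> y}) \<le> sugeno_integral Y M \<mu> h"
  unfolding sugeno_integral_def using assms by (rule SUP_upper)

text \<open>The minimum of \<open>ennreal y\<close> and the measure of the level set is bounded by
  the integral. Since \<open>ennreal y\<close> exceeds the integral, the measure must be the smaller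
  of the two.\<close>

lemma measure_level_le_sugeno_integral:
  assumes "y \<in> Y" "sugeno_integral Y M \<mu> h < ennreal y"
  shows "\<mu> {x \<in> space M. h x \<ge> y} \<le> sugeno_integral Y M \<mu> h"
  using sugeno_integral_upper[OF assms(1), of \<mu> M h] assms(2) by (auto simp: min_le_iff_disj)

text \<open>Closure of \<open>Y\<close> under passing to smaller nonnegative levels treats [0,1] and
  [0,\<infinity>) together.\<close>

lemma sugeno_integral_add_le:
  assumes Y: "\<And>y. y \<in> Y \<Longrightarrow> {0..y} \<subseteq> Y"
    and mono: "monotone_measure M \<mu>" and sub: "subadditive_set_function M \<mu>"
    and [measurable]: "f \<in> borel_measurable M" "g \<in> borel_measurable M"
  shows "sugeno_integral Y M \<mu> (\<lambda>x. f x + g x)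
    \<le> sugeno_integral Y M \<mu> f + sugeno_integral Y M \<mu> g"
    (is "_ \<le> ?p + ?q")
  unfolding sugeno_integral_def[of Y M \<mu> "\<lambda>x. f x + g x"]
proof (rule SUP_least)
  fix y assume "y \<in> Y"
  show "min (ennreal y) (\<mu> {x \<in> space M. y \<le> f x + g x}) \<le> ?p + ?q"
  proof (cases "ennreal y \<le> ?p + ?q")
    case True
    then show ?thesis by (rule min.coboundedI1)
  next
    case False
    then have lt: "?p + ?q < ennreal y" by simp
    \<comment> \<open>Lying below a real level, both integrals are finite, so the level can be split
      by real arithmetic.\<close>
    then have "?p + ?q < top" by (rule order.strict_trans[OF _ ennreal_less_top])
    then have "?p < top" "?q < top" by auto
    then obtain p q where p: "?p = ennreal p" "0 \<le> p" and q: "?q = ennreal q" "0 \<le> q"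
      by (auto simp: less_top_ennreal)
    have less: "p + q < y"
      using lt p q by (simp add: ennreal_less_iff flip: ennreal_plus)
    \<comment> \<open>The positive excess of \<open>y\<close> over \<open>p + q\<close> is shared
      equally, so that each part strictly exceeds its integral.\<close>
    define a where "a = p + (y - p - q) / 2"
    define b where "b = q + (y - p - q) / 2"
    have ab: "p < a" "q < b" "a + b = y"
      using less by (simp_all add: a_def b_def field_simps)
    \<comment> \<open>Both parts are nonnegative with sum \<open>y\<close>, hence lie in
      \<open>{0..y}\<close>.\<close>
    have "a \<in> Y" "b \<in> Y"
      using Y[OF \<open>y \<in> Y\<close>] ab p q by auto
    let ?A = "{x \<in> space M. f x \<ge> a}" and ?B = "{x \<in> space M. g x \<ge> b}"
    have "\<mu> {x \<in> space M. y \<le> f x + g x} \<le> \<mu> (?A \<union> ?B)"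
      using ab by (intro monotone_measure_mono[OF mono]) auto
    also have "\<dots> \<le> \<mu> ?A + \<mu> ?B"
      using sub by (simp add: subadditive_set_function_def)
    also have "\<dots> \<le> ?p + ?q"
      using \<open>a \<in> Y\<close> \<open>b \<in> Y\<close> ab p q
      by (intro add_mono measure_level_le_sugeno_integral) (simp_all add: ennreal_less_iff)
    finally show ?thesis by (rule min.coboundedI2)
  qed
qed

lemma sugeno_integral_indicator_le:
  assumes "monotone_measure M \<mu>" "A \<in> sets M"
  shows "sugeno_integral Y M \<mu> (\<lambda>x. c * indicator A x) \<le> \<mu> A"
  unfolding sugeno_integral_def
proof (rule SUP_least)
  fix y
  note [measurable] = assms(2)
  show "min (ennreal y) (\<mu> {x \<in> space M. y \<le> c * indicator A x}) \<le> \<mu> A"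
  \<comment> \<open>For \<open>y \<le> 0\<close> the level set can be larger than \<open>A\<close>,
    but then \<open>ennreal y\<close> is 0 and so is the minimum. A positive level is reached only
    inside \<open>A\<close>.\<close>
  proof (cases "y \<le> 0")
    case True
    then show ?thesis by (simp add: ennreal_neg)
  next
    case False
    then have "{x \<in> space M. y \<le> c * indicator A x} \<subseteq> A"
      by (auto simp: indicator_def split: if_splits)
    then have "\<mu> {x \<in> space M. y \<le> c * indicator A x} \<le> \<mu> A"
      by (intro monotone_measure_mono[OF assms(1)]) simp_all
    then show ?thesis by (rule min.coboundedI2)
  qed
qed

text \<open>The single level \<open>c\<close> suffices: for \<open>c > 0\<close> its level set is
  exactly \<open>A\<close>, and the two arguments of the minimum agree because
  \<open>\<mu> A = ennreal c\<close>.\<close>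

lemma le_sugeno_integral_indicator:
  assumes "A \<in> sets M" "\<mu> A = ennreal c" "c \<in> Y"
  shows "\<mu> A \<le> sugeno_integral Y M \<mu> (\<lambda>x. c * indicator A x)"
proof (cases "c \<le> 0")
  case True
  then show ?thesis by (simp add: assms(2) ennreal_neg)
next
  case False
  then have "{x \<in> space M. c \<le> c * indicator A x} = A"
    using sets.sets_into_space[OF assms(1)] by (auto simp: indicator_def split: if_splits)
  then show ?thesis
    using sugeno_integral_upper[OF assms(3), of \<mu> M "\<lambda>x. c * indicator A x"] assms(2) by simp
qed

lemma subadditive_if_sugeno_integral_add_le:
  assumes mono: "monotone_measure M \<mu>" and fin: "\<mu> (space M) < \<infinity>"
    and "0 \<in> Y" and Y: "\<And>A c. A \<in> sets M \<Longrightarrow> \<mu> A = ennreal c \<Longrightarrow> 0 \<le> c \<Longrightarrow> c \<in> Y"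
    and le: "\<And>f g. f \<in> M \<rightarrow>\<^sub>M restrict_space borel Y \<Longrightarrow> g \<in> M \<rightarrow>\<^sub>M restrict_space borel Y \<Longrightarrow>
      sugeno_integral Y M \<mu> (\<lambda>x. f x + g x)
        \<le> sugeno_integral Y M \<mu> f + sugeno_integral Y M \<mu> g"
  shows "subadditive_set_function M \<mu>"
  unfolding subadditive_set_function_def
proof (intro ballI)
  fix A B assume [measurable]: "A \<in> sets M" "B \<in> sets M"
  have "\<mu> (A \<union> B) \<le> \<mu> (space M)"
    by (intro monotone_measure_mono[OF mono] sets.sets_into_space) auto
  \<comment> \<open>Finiteness turns the measure of the union into a real number, which can serve
    both as a function value and as a level in \<open>Y\<close>.\<close>
  then have "\<mu> (A \<union> B) < top" using fin by (simp add: le_less_trans)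
  then obtain c where c: "\<mu> (A \<union> B) = ennreal c" "0 \<le> c"
    by (auto simp: less_top_ennreal)
  have "c \<in> Y" using c by (intro Y[of "A \<union> B"]) auto
  have meas: "(\<lambda>x. c * indicator D x) \<in> M \<rightarrow>\<^sub>M restrict_space borel Y" if "D \<in> sets M" for D
    using that \<open>c \<in> Y\<close> \<open>0 \<in> Y\<close>
    by (intro measurable_restrict_space2) (auto simp: indicator_def)
  have split: "c * indicator A x + c * indicator (B - A) x = c * indicator (A \<union> B) x" for x
    by (auto simp: indicator_def)
  have "\<mu> (A \<union> B) \<le> sugeno_integral Y M \<mu> (\<lambda>x. c * indicator (A \<union> B) x)"
    using c \<open>c \<in> Y\<close> by (intro le_sugeno_integral_indicator) auto
  also have "\<dots> \<le> sugeno_integral Y M \<mu> (\<lambda>x. c * indicator A x)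
      + sugeno_integral Y M \<mu> (\<lambda>x. c * indicator (B - A) x)"
    using le[OF meas[of A] meas[of "B - A"]] by (simp add: split)
  also have "\<dots> \<le> \<mu> A + \<mu> (B - A)"
    by (intro add_mono sugeno_integral_indicator_le[OF mono]) auto
  \<comment> \<open>Monotonicity undoes the replacement of \<open>B\<close> by \<open>B - A\<close>,
    which had made the supports disjoint.\<close>
  also have "\<dots> \<le> \<mu> A + \<mu> B"
    by (intro add_left_mono monotone_measure_mono[OF mono]) auto
  finally show "\<mu> (A \<union> B) \<le> \<mu> A + \<mu> B" .
qed

theorem theorem5:
  fixes Y :: "real set" and M :: "'a measure" and \<mu> :: "'a set \<Rightarrow> ennreal"
  assumes "Y = {0..1} \<or> Y = {0..}"
    and "monotone_measure M \<mu>"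
    and "Y = {0..1} \<Longrightarrow> \<forall>A\<in>sets M. \<mu> A \<le> 1"
  shows "(subadditive_set_function M \<mu> \<longrightarrow>
      (\<forall>f \<in> M \<rightarrow>\<^sub>M restrict_space borel Y. \<forall>g \<in> M \<rightarrow>\<^sub>M restrict_space borel Y.
         sugeno_integral Y M \<mu> (\<lambda>x. f x + g x)
           \<le> sugeno_integral Y M \<mu> f + sugeno_integral Y M \<mu> g)) \<and>
    ((\<forall>f \<in> M \<rightarrow>\<^sub>M restrict_space borel Y. \<forall>g \<in> M \<rightarrow>\<^sub>M restrict_space borel Y.
         sugeno_integral Y M \<mu> (\<lambda>x. f x + g x)
           \<le> sugeno_integral Y M \<mu> f + sugeno_integral Y M \<mu> g) \<and>
      \<mu> (space M) < \<infinity> \<longrightarrow> subadditive_set_function M \<mu>)"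
proof (intro conjI impI ballI)
  fix f g
  assume sub: "subadditive_set_function M \<mu>"
    and "f \<in> M \<rightarrow>\<^sub>M restrict_space borel Y" "g \<in> M \<rightarrow>\<^sub>M restrict_space borel Y"
  then have "f \<in> borel_measurable M" "g \<in> borel_measurable M"
    by (simp_all add: measurable_restrict_space2_iff)
  then show "sugeno_integral Y M \<mu> (\<lambda>x. f x + g x)
      \<le> sugeno_integral Y M \<mu> f + sugeno_integral Y M \<mu> g"
    using assms(1) by (intro sugeno_integral_add_le[OF _ assms(2) sub]) auto
next
  assume *: "(\<forall>f \<in> M \<rightarrow>\<^sub>M restrict_space borel Y. \<forall>g \<in> M \<rightarrow>\<^sub>M restrict_space borel Y.
      sugeno_integral Y M \<mu> (\<lambda>x. f x + g x)
        \<le> sugeno_integral Y M \<mu> f + sugeno_integral Y M \<mu> g) \<and> \<mu> (space M) < \<infinity>"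
  \<comment> \<open>For \<open>Y = {0..1}\<close> this rests on the bound of \<open>\<mu>\<close> by
    1.\<close>
  have "c \<in> Y" if "A \<in> sets M" "\<mu> A = ennreal c" "0 \<le> c" for A c
    using assms(1)
  proof
    assume "Y = {0..1}"
    with assms(3) that show ?thesis by fastforce
  qed (use that in simp)
  moreover have "0 \<in> Y" using assms(1) by auto
  ultimately show "subadditive_set_function M \<mu>"
    using * by (intro subadditive_if_sugeno_integral_add_le[OF assms(2), where Y = Y]) blast+
qed

end
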